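(* Let $g$ be a continuous concave distortion function and let $\rho_g:\mathcal X\to\mathbb R$ be the associated distortion risk measure. Let $F_0\in\mathbb F_{\mathcal X}$, let $\phi$ be a weight function, and assume: (a) the set of points $x\in(F_0^{\rightarrow}(0),F_0^{\leftarrow}(1))$ for which $g$ is not differentiable at $F_0(x)$ has Lebesgue measure zero; (b) $\int_{F_0^{\rightarrow}(0)}^{F_0^{\leftarrow}(1)}\frac{g(\gamma F_0(x))}{F_0(x)\phi(x)}\,dx<\infty$ for some $\gamma\in(0,1)$. Then the functional $\mathcal R_g:\mathbb F_{\mathcal X}\to\mathbb R$, $\mathcal R_g(F_X)=\rho_g(X)$, is quasi-Hadamard differentiable at $F_0$ tangentially to $C_{\phi,F_0}\langle D_{\phi,F_0}\rangle$ with quasi-Hadamard derivative $$\dot{\mathcal R}_g(v)=\int_{F_0^{\rightarrow}(0)}^{F_0^{\leftarrow}(1)}g'(F_0(x))\,v(x)\,dx,\qquad v\in C_{\phi,F_0},$$ where $g'$ denotes the right-sided derivative of $g$.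
   Context: $(\Omega,\mathcal F,\mathbb P)$ is an atomless probability space and $\mathcal X$ is a linear subspace of $L^1(\Omega,\mathcal F,\mathbb P)$ containing $L^\infty(\Omega,\mathcal F,\mathbb P)$. $F_X$ denotes the distribution function of $X$, and $\mathbb F_{\mathcal X}$ the set of distribution functions of elements of $\mathcal X$. For a distribution function $F$, $F^{\leftarrow}(s):=\inf\{x\in\mathbb R:F(x)\ge s\}$ and $F^{\rightarrow}(s):=\inf\{x\in\mathbb R:F(x)>s\}$ (values $\pm\infty$ possible). A concave distortion function is a concave nondecreasing $g:[0,1]\to[0,1]$ with $g(0)=0$, $g(1)=1$. The distortion risk measure associated with $g$ is $$\rho_g(X)=\int_{-\infty}^0 g(F_X(x))\,dx-\int_0^\infty\big(1-g(F_X(x))\big)\,dx$$ for random variables $X$ with $\int_0^\infty g(1-F_{|X|}(x))\,dx<\infty$; writing $\rho_g:\mathcal X\to\mathbb R$ includes the requirement that all elements of $\mathcal X$ satisfy this integrability condition. A weight function is a continuous function $\phi:\mathbb R\to[1,\infty)$ that is nonincreasing on $(-\infty,0]$ and nondecreasing on $[0,\infty)$. $D_\phi$ is the space of all càdlàg functions $v$ on $\mathbb R$ with $\|v\|_\phi:=\sup_{x}|v(x)\phi(x)|<\infty$; $D_{\phi,F_0}$ is the subspace of all $v\in D_\phi$ vanishing outside $[F_0^{\rightarrow}(0),F_0^{\leftarrow}(1)]$; $C_{\phi,F_0}$ is the set of all $v\in D_{\phi,F_0}$ whose discontinuity points in $(F_0^{\rightarrow}(0),F_0^{\leftarrow}(1))$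 are discontinuity points of $F_0$. Both carry the norm $\|\cdot\|_\phi$. Quasi-Hadamard differentiability of $\mathcal R_g$ at $F_0$ tangentially to $C_{\phi,F_0}\langle D_{\phi,F_0}\rangle$ with derivative $\dot{\mathcal R}_g$ means: $\dot{\mathcal R}_g:C_{\phi,F_0}\to\mathbb R$ is continuous and $$\lim_{n\to\infty}\Big|\frac{\mathcal R_g(F_0+h_nv_n)-\mathcal R_g(F_0)}{h_n}-\dot{\mathcal R}_g(v)\Big|=0$$ for every triplet $(v,(v_n),(h_n))$ with $v\in C_{\phi,F_0}$, $(v_n)\subset D_{\phi,F_0}$, $\|v_n-v\|_\phi\to0$, $(F_0+h_nv_n)\subset\mathbb F_{\mathcal X}$, $(h_n)\subset(0,\infty)$, $h_n\to0$. *)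

theory Defs
  imports "HOL-Probability.Probability"
begin

section \<open>Random variables and their distribution functions\<close>

definition atomless :: "'a measure \<Rightarrow> bool" where
  "atomless M \<longleftrightarrow>
    (\<forall>A\<in>sets M. emeasure M A > 0 \<longrightarrow>
      (\<exists>B\<in>sets M. B \<subseteq> A \<and> 0 < emeasure M B \<and> emeasure M B < emeasure M A))"

text \<open>
  Elements of \<open>L\<^sup>1\<close> are represented by integrable functions. A set \<open>XX\<close> as below is automatically
  closed under almost sure equality, because it contains every null function, so it
  corresponds to a linear subspace of the space of equivalence classes.
\<close>

definition subspace_L1_containing_Linf :: "'a measure \<Rightarrow> ('a \<Rightarrow> real) set \<Rightarrow> bool" where
  "subspace_L1_containing_Linf M XX \<longleftrightarrow>
    (\<forall>X\<in>XX. integrable M X) \<and>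
    (\<forall>X. X \<in> borel_measurable M \<and> (\<exists>c. AE w in M. \<bar>X w\<bar> \<le> c) \<longrightarrow> X \<in> XX) \<and>
    (\<forall>X\<in>XX. \<forall>Y\<in>XX. (\<lambda>w. X w + Y w) \<in> XX) \<and>
    (\<forall>X\<in>XX. \<forall>c. (\<lambda>w. c * X w) \<in> XX)"

abbreviation rv_cdf :: "'a measure \<Rightarrow> ('a \<Rightarrow> real) \<Rightarrow> real \<Rightarrow> real" where
  "rv_cdf M X \<equiv> cdf (distr M borel X)"

definition cdfs_of :: "'a measure \<Rightarrow> ('a \<Rightarrow> real) set \<Rightarrow> (real \<Rightarrow> real) set" where
  "cdfs_of M XX = rv_cdf M ` XX"

definition left_quantile :: "(real \<Rightarrow> real) \<Rightarrow> real \<Rightarrow> ereal" where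
  "left_quantile F s = (INF x\<in>{x. F x \<ge> s}. ereal x)"

definition right_quantile :: "(real \<Rightarrow> real) \<Rightarrow> real \<Rightarrow> ereal" where
  "right_quantile F s = (INF x\<in>{x. F x > s}. ereal x)"

section \<open>Distortion risk measures\<close>

text \<open>Functions on \<open>[0,1]\<close> are total functions on the reals whose values outside \<open>[0,1]\<close> are irrelevant.\<close>

definition concave_distortion :: "(real \<Rightarrow> real) \<Rightarrow> bool" where
  "concave_distortion g \<longleftrightarrow>
    g \<in> {0..1} \<rightarrow> {0..1} \<and> concave_on {0..1} g \<and> mono_on {0..1} g \<and> g 0 = 0 \<and> g 1 = 1"

definition distortion_integrable :: "'a measure \<Rightarrow> (real \<Rightarrow> real) \<Rightarrow> ('a \<Rightarrow> real) \<Rightarrow> bool" where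
  "distortion_integrable M g X \<longleftrightarrow>
    (\<integral>\<^sup>+x\<in>{0..}. ennreal (g (1 - rv_cdf M (\<lambda>w. \<bar>X w\<bar>) x)) \<partial>lborel) < \<infinity>"

definition distortion_risk_measure :: "'a measure \<Rightarrow> (real \<Rightarrow> real) \<Rightarrow> ('a \<Rightarrow> real) \<Rightarrow> real" where
  "distortion_risk_measure M g X =
    (LBINT x=-\<infinity>..0. g (rv_cdf M X x)) - (LBINT x=0..\<infinity>. 1 - g (rv_cdf M X x))"

text \<open>
  Only used where the one-sided derivative exists, such as at points of \<open>(0,1)\<close> for
  a function that is concave on \<open>[0,1]\<close>.
\<close>

definition right_deriv :: "(real \<Rightarrow> real) \<Rightarrow> real \<Rightarrow> real" where
  "right_deriv g s = (THE D. (g has_real_derivative D) (at_right s))"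

section \<open>Weighted spaces of cadlag functions\<close>

definition weight_function :: "(real \<Rightarrow> real) \<Rightarrow> bool" where
  "weight_function \<phi> \<longleftrightarrow>
    continuous_on UNIV \<phi> \<and> (\<forall>x. \<phi> x \<ge> 1) \<and> antimono_on {..0} \<phi> \<and> mono_on {0..} \<phi>"

definition cadlag :: "(real \<Rightarrow> real) \<Rightarrow> bool" where
  "cadlag v \<longleftrightarrow> (\<forall>x. continuous (at_right x) v \<and> (\<exists>l. (v \<longlongrightarrow> l) (at_left x)))"

text \<open>On functions \<open>v\<close> for which \<open>v \<phi>\<close> is unbounded, the following supremum is meaningless.\<close>

definition weighted_norm :: "(real \<Rightarrow> real) \<Rightarrow> (real \<Rightarrow> real) \<Rightarrow> real" where
  "weighted_norm \<phi> v = (SUP x. \<bar>v x * \<phi> x\<bar>)"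

definition D_weight :: "(real \<Rightarrow> real) \<Rightarrow> (real \<Rightarrow> real) set" where
  "D_weight \<phi> = {v. cadlag v \<and> bdd_above (range (\<lambda>x. \<bar>v x * \<phi> x\<bar>))}"

definition D_weight_at :: "(real \<Rightarrow> real) \<Rightarrow> (real \<Rightarrow> real) \<Rightarrow> (real \<Rightarrow> real) set" where
  "D_weight_at \<phi> F0 =
    {v \<in> D_weight \<phi>. \<forall>x. ereal x \<notin> {right_quantile F0 0..left_quantile F0 1} \<longrightarrow> v x = 0}"

definition C_weight_at :: "(real \<Rightarrow> real) \<Rightarrow> (real \<Rightarrow> real) \<Rightarrow> (real \<Rightarrow> real) set" where
  "C_weight_at \<phi> F0 =
    {v \<in> D_weight_at \<phi> F0.
      \<forall>x\<in>einterval (right_quantile F0 0) (left_quantile F0 1). \<not> isCont v x \<longrightarrow> \<not> isCont F0 x}"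

section \<open>Quasi-Hadamard differentiability\<close>

text \<open>
  \<open>R\<close> is a functional on \<open>FF\<close>, the linear spaces \<open>C \<subseteq> D\<close> carry the norm \<open>N\<close>, and \<open>R'\<close> is
  the derivative of \<open>R\<close> at \<open>F0\<close> tangentially to \<open>C\<langle>D\<rangle>\<close>.
\<close>

definition has_quasi_hadamard_derivative ::
  "(real \<Rightarrow> real) set \<Rightarrow> ((real \<Rightarrow> real) \<Rightarrow> real) \<Rightarrow> (real \<Rightarrow> real) \<Rightarrow>
   (real \<Rightarrow> real) set \<Rightarrow> (real \<Rightarrow> real) set \<Rightarrow> ((real \<Rightarrow> real) \<Rightarrow> real) \<Rightarrow>
   ((real \<Rightarrow> real) \<Rightarrow> real) \<Rightarrow> bool" where
  "has_quasi_hadamard_derivative FF R F0 C D N R' \<longleftrightarrow>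
    (\<forall>v\<in>C. \<forall>e>0. \<exists>d>0. \<forall>w\<in>C. N (\<lambda>x. w x - v x) < d \<longrightarrow> \<bar>R' w - R' v\<bar> < e) \<and>
    (\<forall>v vs h.
      v \<in> C \<and> (\<forall>n. vs n \<in> D) \<and> (\<lambda>n::nat. N (\<lambda>x. vs n x - v x)) \<longlonglongrightarrow> 0 \<and>
      (\<forall>n. (\<lambda>x. F0 x + h n * vs n x) \<in> FF) \<and> (\<forall>n. h n > 0) \<and> h \<longlonglongrightarrow> 0 \<longrightarrow>
      (\<lambda>n. \<bar>(R (\<lambda>x. F0 x + h n * vs n x) - R F0) / h n - R' v\<bar>) \<longlonglongrightarrow> 0)"

end

theory Submission
  imports Defs
begin

text \<open>
  For a concave distortion \<open>g\<close>, every \<open>s\<close> in \<open>(0,1)\<close> and every \<open>t\<close> in \<open>[0,1]\<close> satisfy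
  \<open>\<bar>g t - g s\<bar> \<le> \<bar>t - s\<bar> g(\<gamma> s) / (\<gamma> (1 - \<gamma>) s)\<close>. Increments upwards, and downwards to
  \<open>t \<ge> \<gamma> s\<close>, are controlled by the slope of the chord from the origin to \<open>(\<gamma> s, g(\<gamma> s))\<close>. If
  \<open>t < \<gamma> s\<close>, then \<open>\<bar>t - s\<bar>\<close> is comparable to \<open>s\<close>, and \<open>g s\<close> itself is a sufficient bound. Hence the
  difference quotients of \<open>g\<close> along \<open>F0 + h v\<close> are dominated by a constant multiple of
  \<open>g(\<gamma> F0) / (F0 \<phi>)\<close>, and dominated convergence applies.
\<close>

section \<open>Concave distortion functions\<close>

lemma concave_distortion_bounds:
  assumes "concave_distortion g" "0 \<le> s" "s \<le> 1"
  shows "0 \<le> g s" "g s \<le> 1"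
  using assms by (auto simp: concave_distortion_def Pi_iff)

lemma concave_distortion_mono:
  assumes "concave_distortion g" "0 \<le> s" "s \<le> t" "t \<le> 1"
  shows "g s \<le> g t"
  using assms by (auto simp: concave_distortion_def intro!: mono_onD[of "{0..1}" g])

text \<open>Since \<open>g 0 = 0\<close>, concavity along the segment from the origin to
  \<open>(t, g t)\<close> keeps the graph above that chord, so the slope seen from the origin can
  only fall.\<close>

lemma concave_distortion_chord_antimono:
  assumes g: "concave_distortion g" and st: "0 < s" "s \<le> t" "t \<le> 1"
  shows "g t / t \<le> g s / s"
proof -
  have "concave_on {0..1} g" and g0: "g 0 = 0"
    using g by (auto simp: concave_distortion_def)
  then have "(1 - s / t) * g 0 + (s / t) * g t \<le> g ((1 - s / t) *\<^sub>R 0 + (s / t) *\<^sub>R t)"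
    using st by (intro concave_onD) auto
  then show ?thesis
    using st by (simp add: g0 field_simps)
qed

lemma concave_distortion_ge_id:
  assumes "concave_distortion g" "0 \<le> s" "s \<le> 1"
  shows "s \<le> g s"
proof (cases "s = 0")
  case False
  then show ?thesis
    using concave_distortion_chord_antimono[OF assms(1), of s 1] assms
    by (auto simp: concave_distortion_def field_simps)
qed (use assms in \<open>auto simp: concave_distortion_def\<close>)

lemma concave_distortion_increment_le:
  assumes g: "concave_distortion g" and st: "0 < s" "s \<le> t" "t \<le> 1"
  shows "g t - g s \<le> (t - s) * (g s / s)"
  using concave_distortion_chord_antimono[OF assms] st by (simp add: field_simps)

text \<open>The factor of \<open>\<bar>t - s\<bar>\<close> depends on \<open>s\<close> and
  \<open>c\<close> only. For \<open>s = F0 x\<close> and \<open>t = F0 x + h n * vs n x\<close>,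
  division by \<open>h n\<close> therefore leaves a bound without \<open>h n\<close>.\<close>

lemma concave_distortion_increment_bound:
  assumes g: "concave_distortion g" and c: "0 < c" "c < 1"
    and s: "0 < s" "s < 1" and t: "0 \<le> t" "t \<le> 1"
  shows "\<bar>g t - g s\<bar> \<le> \<bar>t - s\<bar> * (g (c * s) / s / (c * (1 - c)))"
proof -
  define r where "r = g (c * s) / (c * s)"
  have cs: "0 < c * s" "c * s < s" using c s by auto
  have r_nonneg: "0 \<le> r"
    unfolding r_def using concave_distortion_bounds[OF g, of "c * s"] cs s by auto
  have r_le: "r \<le> r / (1 - c)"
    using c r_nonneg by (simp add: field_simps)
  have s_le: "g s / s \<le> r"
    unfolding r_def using concave_distortion_chord_antimono[OF g, of "c * s" s] cs s by auto
  have "\<bar>g t - g s\<bar> \<le> \<bar>t - s\<bar> * (r / (1 - c))"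
  proof -
    consider "s \<le> t" | "c * s \<le> t" "t < s" | "t < c * s" by linarith
    then show ?thesis
    proof cases
      case 1
      have "g t - g s \<le> (t - s) * (g s / s)"
        using concave_distortion_increment_le[OF g] s t 1 by auto
      also have "\<dots> \<le> (t - s) * (r / (1 - c))"
        using 1 s_le r_le by (intro mult_left_mono) auto
      finally show ?thesis
        using concave_distortion_mono[OF g, of s t] s t 1 by auto
    next
      case 2
      have "g s - g t \<le> (s - t) * (g t / t)"
        using concave_distortion_increment_le[OF g, of t s] s 2 cs by auto
      also have "\<dots> \<le> (s - t) * (r / (1 - c))"
      proof (intro mult_left_mono)
        have "g t / t \<le> r"
          unfolding r_def using concave_distortion_chord_antimono[OF g, of "c * s" t] cs t 2 by auto
        then show "g t / t \<le> r / (1 - c)" using r_le by linarith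
      qed (use 2 in auto)
      finally show ?thesis
        using concave_distortion_mono[OF g, of t s] s t 2 by auto
    next
      case 3
      have "g s - g t \<le> g s"
        using concave_distortion_bounds[OF g] t by auto
      also have "\<dots> \<le> s * r"
        using s_le s by (simp add: field_simps)
      \<comment> \<open>In this case \<open>s - t\<close> exceeds \<open>(1 - c) * s\<close>; this
        is the origin of the factor \<open>1 / (1 - c)\<close>.\<close>
      also have "\<dots> = ((1 - c) * s) * (r / (1 - c))"
        using c by (simp add: field_simps)
      also have "\<dots> \<le> (s - t) * (r / (1 - c))"
        using c r_nonneg 3 by (intro mult_right_mono) (auto simp: algebra_simps)
      finally show ?thesis
        using concave_distortion_mono[OF g, of t s] s t 3 cs by auto
    qed
  qed
  then show ?thesis
    unfolding r_def by (simp add: field_simps)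
qed

section \<open>One-sided derivatives as limits of difference quotients\<close>

lemma right_deriv_eq:
  assumes "(g has_real_derivative D) (at_right s)"
  shows "right_deriv g s = D"
  unfolding right_deriv_def
proof (rule the_equality)
  show "(g has_real_derivative D) (at_right s)" by (rule assms)
next
  fix E assume "(g has_real_derivative E) (at_right s)"
  then show "E = D"
    using assms tendsto_unique[OF trivial_limit_at_right_real]
    unfolding has_field_derivative_iff by blast
qed

text \<open>By concavity the difference quotient grows as \<open>t\<close> decreases to
  \<open>s\<close>, and the chord from the origin bounds it by \<open>g s / s\<close>. A bounded
  monotone quotient has a finite limit.\<close>

lemma tendsto_right_deriv:
  assumes g: "concave_distortion g" and s: "0 < s" "s < 1"
  shows "((\<lambda>t. (g t - g s) / (t - s)) \<longlongrightarrow> right_deriv g s) (at_right s)"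
proof -
  define B where "B = g s / s"
  \<comment> \<open>The sign is flipped because \<open>Lim_right_bound\<close> asks for a
    nondecreasing function that is bounded below.\<close>
  define f where "f = (\<lambda>t. - ((g t - g s) / (t - s)))"
  have conc: "concave_on {0..1} g" using g by (simp add: concave_distortion_def)
  have "(f \<longlongrightarrow> Inf (f ` ({s<..} \<inter> {s<..<1}))) (at s within ({s<..} \<inter> {s<..<1}))"
  proof (rule Lim_right_bound)
    fix a b assume ab: "a \<in> {s<..<1}" "b \<in> {s<..<1}" "s < a" "a \<le> b"
    have "concave_on {s..b} g"
      using conc s ab by (auto simp: concave_on_iff convex_real_interval)
    then have "(g b - g s) / (b - s) * (a - s) + g s \<le> g a"
      using concave_onD_Icc'[of s b g a] ab by auto
    then show "f a \<le> f b"
      using ab unfolding f_def by (auto simp: field_simps)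
  next
    fix a assume a: "a \<in> {s<..<1}" "s < a"
    have "g a - g s \<le> (a - s) * (g s / s)"
      using a s by (intro concave_distortion_increment_le[OF g]) auto
    then have "(g a - g s) / (a - s) \<le> B"
      using a unfolding B_def by (subst pos_divide_le_eq) (auto simp: mult.commute)
    then show "- B \<le> f a" unfolding f_def by simp
  qed
  moreover have "{s<..} \<inter> {s<..<1} = {s<..<1}" by auto
  moreover have "at s within {s<..<1} = at_right s"
    using s by (intro at_within_nhd[of s "{..<1}"]) auto
  ultimately obtain l where "(f \<longlongrightarrow> l) (at_right s)"
    by auto
  from tendsto_minus[OF this] have "((\<lambda>t. (g t - g s) / (t - s)) \<longlongrightarrow> - l) (at_right s)"
    by (simp add: f_def)
  moreover from this have "right_deriv g s = - l"
    by (intro right_deriv_eq) (simp add: has_field_derivative_iff)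
  ultimately show ?thesis by simp
qed

text \<open>A countable family of quotients gives both measurability of the derivative and its
  bound. \<open>min 1\<close> keeps every argument in [0,1]; since \<open>s < 1\<close>, it is
  eventually inactive.\<close>

lemma right_deriv_tendsto_sequentially:
  assumes g: "concave_distortion g" and s: "0 < s" "s < 1"
  shows "(\<lambda>n. real (Suc n) * (g (min 1 (s + 1 / real (Suc n))) - g s)) \<longlonglongrightarrow> right_deriv g s"
proof -
  have lim: "(\<lambda>n. s + 1 / real (Suc n)) \<longlonglongrightarrow> s"
    using tendsto_add[OF tendsto_const LIMSEQ_Suc[OF lim_1_over_n], of s] by simp
  then have "filterlim (\<lambda>n. s + 1 / real (Suc n)) (at_right s) sequentially"
    by (auto simp: filterlim_at)
  from filterlim_compose[OF tendsto_right_deriv[OF assms] this]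
  have *: "(\<lambda>n. (g (s + 1 / real (Suc n)) - g s) / (s + 1 / real (Suc n) - s))
    \<longlonglongrightarrow> right_deriv g s" .
  have "\<forall>\<^sub>F n in sequentially. s + 1 / real (Suc n) < 1"
    using order_tendstoD(2)[OF lim s(2)] .
  then show ?thesis
    by (intro Lim_transform_eventually[OF *]) (auto elim!: eventually_mono simp: field_simps)
qed

text \<open>The increment bound applies to each quotient of the approximating sequence, whose step
  is at most \<open>1 / real (Suc n)\<close>, and it survives the limit.\<close>

lemma right_deriv_bound:
  assumes g: "concave_distortion g" and c: "0 < c" "c < 1" and s: "0 < s" "s < 1"
  shows "\<bar>right_deriv g s\<bar> \<le> g (c * s) / s / (c * (1 - c))"
proof (rule LIMSEQ_le_const2[OF tendsto_rabs[OF right_deriv_tendsto_sequentially[OF g s]]],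
    intro exI[of _ 0] allI impI)
  fix n :: nat
  define t where "t = min 1 (s + 1 / real (Suc n))"
  define B where "B = g (c * s) / s / (c * (1 - c))"
  have t: "0 \<le> t" "t \<le> 1" "\<bar>t - s\<bar> \<le> 1 / real (Suc n)"
    using s unfolding t_def by (auto simp: min_def)
  have "0 \<le> c * s" "c * s \<le> 1"
    using c s by (auto intro: mult_le_one)
  then have B: "0 \<le> B"
    unfolding B_def using concave_distortion_bounds[OF g, of "c * s"] c s by auto
  have "\<bar>g t - g s\<bar> \<le> \<bar>t - s\<bar> * B"
    using concave_distortion_increment_bound[OF g c s t(1,2)] unfolding B_def .
  also have "\<dots> \<le> 1 / real (Suc n) * B"
    using t(3) B by (intro mult_right_mono)
  finally show "\<bar>real (Suc n) * (g t - g s)\<bar> \<le> B"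
    by (simp only: abs_mult abs_of_nat pos_le_divide_eq[OF of_nat_0_less_iff[THEN iffD2, OF zero_less_Suc]]
        times_divide_eq_left mult_1_left mult.commute[of "real (Suc n)"])
qed

text \<open>The displacement \<open>h n * w n\<close> may have either sign or vanish. Two-sided
  differentiability covers both signs, and the Caratheodory form
  \<open>g z - g s = q z * (z - s)\<close> avoids dividing by \<open>w n\<close>.\<close>

lemma difference_quotient_tendsto:
  assumes g: "g differentiable (at s)" and w: "w \<longlonglongrightarrow> l" and h: "h \<longlonglongrightarrow> 0" "\<And>n. h n > (0::real)"
  shows "(\<lambda>n. (g (s + h n * w n) - g s) / h n) \<longlonglongrightarrow> right_deriv g s * l"
proof -
  obtain D where D: "(g has_real_derivative D) (at s)"
    using g by (auto simp: real_differentiable_def)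
  have "right_deriv g s = D"
    using D by (intro right_deriv_eq) (rule has_field_derivative_at_within)
  moreover obtain q where q: "\<And>z. g z - g s = q z * (z - s)" "isCont q s" "q s = D"
    using D unfolding CARAT_DERIV by auto
  moreover have "(\<lambda>n. s + h n * w n) \<longlonglongrightarrow> s"
    using tendsto_add[OF tendsto_const tendsto_mult[OF h(1) w], of s] by simp
  then have "(\<lambda>n. q (s + h n * w n) * w n) \<longlonglongrightarrow> D * l"
    using isCont_tendsto_compose[OF q(2)] q(3) w by (intro tendsto_mult) auto
  ultimately show ?thesis
    using h(2) by (simp add: order_less_imp_not_eq2)
qed

section \<open>Distribution functions and distortion risk measures\<close>

text \<open>Right-continuity makes \<open>v x\<close> the limit of the values of \<open>v\<close> at
  grid points approaching \<open>x\<close> from the right. Each approximation factors through a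
  floor function, hence through a countable space.\<close>

lemma cadlag_borel_measurable:
  assumes "cadlag v"
  shows "v \<in> borel_measurable borel"
proof (rule borel_measurable_LIMSEQ_real)
  fix x :: real
  \<comment> \<open>The \<open>+ 1\<close> puts the grid point strictly to the right of
    \<open>x\<close> even when \<open>x\<close> itself lies on the grid, as convergence in
    \<open>at_right x\<close> requires.\<close>
  define y where "y = (\<lambda>n. real_of_int (\<lfloor>real (Suc n) * x\<rfloor> + 1) / real (Suc n))"
  have gt: "x < y n" for n
  proof -
    have "x = real (Suc n) * x / real (Suc n)" by (simp del: of_nat_Suc)
    also have "\<dots> < y n"
      unfolding y_def by (intro divide_strict_right_mono) (simp_all del: of_nat_Suc)
    finally show ?thesis .
  qed
  have le: "y n \<le> x + 1 / real (Suc n)" for n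
  proof -
    have "y n \<le> (real (Suc n) * x + 1) / real (Suc n)"
      unfolding y_def by (intro divide_right_mono) (simp_all del: of_nat_Suc)
    then show ?thesis by (simp add: add_divide_distrib del: of_nat_Suc)
  qed
  have "(\<lambda>n. x + 1 / real (Suc n)) \<longlonglongrightarrow> x"
    using tendsto_add[OF tendsto_const LIMSEQ_Suc[OF lim_1_over_n], of x] by simp
  then have "y \<longlonglongrightarrow> x"
    by (rule tendsto_sandwich[OF _ _ tendsto_const, rotated 2])
      (simp_all add: less_imp_le[OF gt] le del: of_nat_Suc)
  then have y: "filterlim y (at_right x) sequentially"
    unfolding filterlim_at using gt by (simp add: less_imp_neq[symmetric])
  have "(v \<longlongrightarrow> v x) (at_right x)"
    using assms by (auto simp: cadlag_def continuous_within)
  then show "(\<lambda>n. v (y n)) \<longlonglongrightarrow> v x"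
    using y by (rule filterlim_compose)
next
  fix n
  have "(\<lambda>x::real. \<lfloor>real (Suc n) * x\<rfloor>) \<in> measurable borel (count_space UNIV)"
    by measurable
  from measurable_compose[OF this, of "\<lambda>k. v (real_of_int (k + 1) / real (Suc n))" borel]
  show "(\<lambda>x. v (real_of_int (\<lfloor>real (Suc n) * x\<rfloor> + 1) / real (Suc n))) \<in> borel_measurable borel"
    by simp
qed

lemma concave_distortion_comp_borel:
  fixes F :: "real \<Rightarrow> real"
  assumes "concave_distortion g" "mono F" "\<And>x. 0 \<le> F x" "\<And>x. F x \<le> 1"
  shows "(\<lambda>x. g (F x)) \<in> borel_measurable borel"
proof (rule borel_measurable_mono, rule monoI)
  show "g (F x) \<le> g (F y)" if "x \<le> y" for x y
    using assms that by (intro concave_distortion_mono[OF assms(1)]) (auto dest: monoD)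
qed

lemma (in prob_space) rv_cdf_eq_prob:
  assumes "random_variable borel X"
  shows "rv_cdf M X x = prob {w \<in> space M. X w \<le> x}"
  using assms by (simp add: cdf_def measure_distr vimage_def Int_def conj_commute)

lemma (in prob_space) rv_cdf_bounds:
  assumes "random_variable borel X"
  shows "0 \<le> rv_cdf M X x" "rv_cdf M X x \<le> 1" "mono (rv_cdf M X)"
proof -
  interpret D: real_distribution "distr M borel X"
    using assms by simp
  show "0 \<le> rv_cdf M X x" "rv_cdf M X x \<le> 1" "mono (rv_cdf M X)"
    using D.cdf_nonneg D.cdf_bounded_prob D.cdf_nondecreasing by (auto intro: monoI)
qed

text \<open>This makes both integrals in the risk measure converge separately. The left tail is
  compared with a rescaled tail of \<open>\<bar>X w\<bar>\<close>; on the right,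
  \<open>s \<le> g s\<close> is used twice, in
  \<open>1 - g F \<le> 1 - F \<le> 1 - G \<le> g (1 - G)\<close>.\<close>

lemma (in prob_space) distortion_integrable_tails:
  assumes g: "concave_distortion g" and X: "random_variable borel X"
    and int: "distortion_integrable M g X"
  shows "set_integrable lborel {..<0} (\<lambda>x. g (rv_cdf M X x))"
    and "set_integrable lborel {0<..} (\<lambda>x. 1 - g (rv_cdf M X x))"
proof -
  define F where "F = rv_cdf M X"
  define G where "G = rv_cdf M (\<lambda>w. \<bar>X w\<bar>)"
  define H where "H = (\<lambda>y. indicator {0..} y * g (1 - G y))"
  have absX: "random_variable borel (\<lambda>w. \<bar>X w\<bar>)" using X by measurable
  note Fb = rv_cdf_bounds[OF X, folded F_def]
  note Gb = rv_cdf_bounds[OF absX, folded G_def]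
  have F: "F x = prob {w \<in> space M. X w \<le> x}" for x
    unfolding F_def by (rule rv_cdf_eq_prob[OF X])
  have G: "G x = prob {w \<in> space M. \<bar>X w\<bar> \<le> x}" for x
    unfolding G_def by (rule rv_cdf_eq_prob[OF absX])
  have gF[measurable]: "(\<lambda>x. g (F x)) \<in> borel_measurable borel"
    by (rule concave_distortion_comp_borel[OF g Fb(3,1,2)])
  have "antimono (\<lambda>x. g (1 - G x))"
    using Gb by (intro antimonoI concave_distortion_mono[OF g]) (auto dest: monoD)
  then have "mono (\<lambda>x. - g (1 - G x))"
    by (auto simp: mono_def antimono_def)
  then have "(\<lambda>x. - (- g (1 - G x))) \<in> borel_measurable borel"
    by (intro borel_measurable_uminus borel_measurable_mono)
  then have [measurable]: "(\<lambda>x. g (1 - G x)) \<in> borel_measurable borel"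
    by simp
  have gG: "0 \<le> g (1 - G y)" for y
    using Gb concave_distortion_bounds[OF g] by auto
  have H: "integrable lborel H"
  proof (rule integrableI_nonneg)
    show "H \<in> borel_measurable lborel" unfolding H_def by measurable
    show "AE x in lborel. 0 \<le> H x" using gG by (auto simp: H_def)
    have "(\<integral>\<^sup>+x. ennreal (H x) \<partial>lborel) = (\<integral>\<^sup>+x\<in>{0..}. ennreal (g (1 - G x)) \<partial>lborel)"
      by (intro nn_integral_cong) (auto simp: H_def indicator_def)
    then show "(\<integral>\<^sup>+x. ennreal (H x) \<partial>lborel) < \<infinity>"
      using int by (simp add: distortion_integrable_def G_def)
  qed
  \<comment> \<open>Halving the argument avoids comparing \<open>P(\<bar>X\<bar> \<ge> y)\<close> with \<open>P(\<bar>X\<bar> > y)\<close> at atoms.\<close>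
  have H2: "integrable lborel (\<lambda>x. H (0 + (- 1 / 2) * x))"
    by (rule lborel_integrable_real_affine[OF H]) simp
  have le1: "norm (indicator {..<0} x *\<^sub>R g (F x)) \<le> norm (H (0 + (- 1 / 2) * x))" for x
  proof (cases "x < 0")
    case True
    have "F x \<le> prob (space M - {w \<in> space M. \<bar>X w\<bar> \<le> - x / 2})"
      unfolding F using X True by (intro finite_measure_mono) auto
    also have "\<dots> = 1 - G (- x / 2)"
      unfolding G using X by (intro prob_compl) measurable
    finally have "g (F x) \<le> g (1 - G (- x / 2))"
      using Fb Gb by (intro concave_distortion_mono[OF g]) auto
    then show ?thesis
      using True Fb concave_distortion_bounds[OF g] gG by (auto simp: H_def)
  qed simp
  show "set_integrable lborel {..<0} (\<lambda>x. g (rv_cdf M X x))"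
    unfolding set_integrable_def F_def[symmetric]
  proof (rule Bochner_Integration.integrable_bound[OF H2])
    show "(\<lambda>x. indicator {..<0} x *\<^sub>R g (F x)) \<in> borel_measurable lborel"
      by measurable
  qed (use le1 in \<open>blast intro: always_eventually\<close>)
  have le2: "norm (indicator {0<..} x *\<^sub>R (1 - g (F x))) \<le> norm (H x)" for x
  proof (cases "x > 0")
    case True
    have "G x \<le> F x"
      unfolding F G using X by (intro finite_measure_mono) auto
    then have "1 - g (F x) \<le> 1 - G x"
      using concave_distortion_ge_id[OF g, of "F x"] Fb by auto
    also have "\<dots> \<le> g (1 - G x)"
      using concave_distortion_ge_id[OF g] Gb by auto
    finally show ?thesis
      using True Fb concave_distortion_bounds[OF g] by (auto simp: H_def)
  qed simp
  show "set_integrable lborel {0<..} (\<lambda>x. 1 - g (rv_cdf M X x))"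
    unfolding set_integrable_def F_def[symmetric]
  proof (rule Bochner_Integration.integrable_bound[OF H])
    show "(\<lambda>x. indicator {0<..} x *\<^sub>R (1 - g (F x))) \<in> borel_measurable lborel"
      by measurable
  qed (use le2 in \<open>blast intro: always_eventually\<close>)
qed

text \<open>On either half line the integrands differ by \<open>g F - g G\<close>, because the
  constants 1 cancel on the right. The two integrals thus merge into one over the line; the origin,
  in neither half line, is a null set.\<close>

lemma (in prob_space) distortion_risk_measure_diff:
  assumes g: "concave_distortion g" and X: "random_variable borel X" "distortion_integrable M g X"
    and Y: "random_variable borel Y" "distortion_integrable M g Y"
    and S: "AE x in lborel. x \<notin> S \<longrightarrow> rv_cdf M X x = rv_cdf M Y x"
    and [measurable]: "S \<in> sets borel"
  shows "distortion_risk_measure M g X - distortion_risk_measure M g Y =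
    (LINT x|lborel. indicator S x * (g (rv_cdf M X x) - g (rv_cdf M Y x)))"
proof -
  define F where "F = rv_cdf M X"
  define G where "G = rv_cdf M Y"
  have [simp]: "einterval (-\<infinity>) 0 = {..<0::real}" "einterval 0 \<infinity> = {0::real<..}"
    using einterval_eq(3)[of 0] einterval_eq(2)[of 0] by (simp_all only: zero_ereal_def)
  note tX = distortion_integrable_tails[OF g X, folded F_def, unfolded set_integrable_def]
  note tY = distortion_integrable_tails[OF g Y, folded G_def, unfolded set_integrable_def]
  have [measurable]: "(\<lambda>x. g (F x)) \<in> borel_measurable borel" "(\<lambda>x. g (G x)) \<in> borel_measurable borel"
    unfolding F_def G_def
    using rv_cdf_bounds[OF X(1)] rv_cdf_bounds[OF Y(1)]
    by (auto intro!: concave_distortion_comp_borel[OF g])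
  have "distortion_risk_measure M g X - distortion_risk_measure M g Y =
    (LINT x|lborel. (indicator {..<0} x *\<^sub>R g (F x) - indicator {0<..} x *\<^sub>R (1 - g (F x)))
      - (indicator {..<0} x *\<^sub>R g (G x) - indicator {0<..} x *\<^sub>R (1 - g (G x))))"
    using tX tY
    by (simp add: distortion_risk_measure_def interval_lebesgue_integral_def
        set_lebesgue_integral_def F_def[symmetric] G_def[symmetric] del: real_scaleR_def)
  also have "\<dots> = (LINT x|lborel. indicator S x * (g (F x) - g (G x)))"
  proof (rule integral_cong_AE)
    show "AE x in lborel.
      (indicator {..<0} x *\<^sub>R g (F x) - indicator {0<..} x *\<^sub>R (1 - g (F x)))
        - (indicator {..<0} x *\<^sub>R g (G x) - indicator {0<..} x *\<^sub>R (1 - g (G x)))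
      = indicator S x * (g (F x) - g (G x))"
      using S AE_lborel_singleton[of 0]
      by eventually_elim (auto simp: F_def G_def indicator_def)
  qed measurable
  finally show ?thesis by (simp add: F_def G_def)
qed

text \<open>A point above the right quantile exceeds some \<open>y\<close> with
  \<open>F y > 0\<close>; a point below the left quantile cannot belong to the set whose infimum
  that quantile is. Strictness matters, as the slope bounds need values in the open unit
  interval.\<close>

lemma cdf_strict_between_quantiles:
  fixes F :: "real \<Rightarrow> real"
  assumes "mono F" "x \<in> einterval (right_quantile F 0) (left_quantile F 1)"
  shows "0 < F x" "F x < 1"
proof -
  have "right_quantile F 0 < ereal x" and x: "ereal x < left_quantile F 1"
    using assms by (auto simp: einterval_def)
  then obtain y where "F y > 0" "y < x"
    unfolding right_quantile_def by (auto simp: INF_less_iff)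
  then show "0 < F x"
    using monoD[OF assms(1), of y x] by auto
  show "F x < 1"
  proof (rule ccontr)
    assume "\<not> F x < 1"
    then have "left_quantile F 1 \<le> ereal x"
      unfolding left_quantile_def by (intro INF_lower) auto
    then show False using x by simp
  qed
qed

lemma right_quantile_le_left_quantile: "s < t \<Longrightarrow> right_quantile F s \<le> left_quantile F t"
  unfolding right_quantile_def left_quantile_def by (intro INF_superset_mono) auto

section \<open>Weighted sup norms\<close>

text \<open>The supremum in \<open>weighted_norm\<close> is an upper bound only for a bounded
  family; membership of both functions in \<open>D_weight \<phi>\<close> supplies this for their
  difference.\<close>

lemma abs_le_weighted_norm:
  assumes "weight_function \<phi>" "u \<in> D_weight \<phi>" "v \<in> D_weight \<phi>"
  shows "\<bar>u x - v x\<bar> * \<phi> x \<le> weighted_norm \<phi> (\<lambda>x. u x - v x)"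
proof -
  obtain A B where AB: "\<And>x. \<bar>u x * \<phi> x\<bar> \<le> A" "\<And>x. \<bar>v x * \<phi> x\<bar> \<le> B"
    using assms(2,3) unfolding D_weight_def bdd_above_def by blast
  have "\<bar>(u x - v x) * \<phi> x\<bar> \<le> A + B" for x
    using AB[of x] by (simp add: left_diff_distrib)
  then have "bdd_above (range (\<lambda>x. \<bar>(u x - v x) * \<phi> x\<bar>))"
    by (auto simp: bdd_above_def)
  then have "\<bar>(u x - v x) * \<phi> x\<bar> \<le> weighted_norm \<phi> (\<lambda>x. u x - v x)"
    unfolding weighted_norm_def by (intro cSUP_upper) auto
  moreover have "0 \<le> \<phi> x"
    using assms(1) order_trans[OF zero_le_one] by (auto simp: weight_function_def)
  ultimately show ?thesis by (simp add: abs_mult)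
qed

section \<open>Quasi-Hadamard differentiability\<close>

theorem theorem2p7:
  fixes M :: "'a measure" and XX :: "('a \<Rightarrow> real) set"
    and g F0 \<phi> :: "real \<Rightarrow> real" and R :: "(real \<Rightarrow> real) \<Rightarrow> real"
  assumes "prob_space M" and "atomless M"
    and "subspace_L1_containing_Linf M XX"
    and "concave_distortion g" and "continuous_on {0..1} g"
    and "\<forall>X\<in>XX. distortion_integrable M g X"
    and "F0 \<in> cdfs_of M XX"
    and "weight_function \<phi>"
    and a: "{x \<in> einterval (right_quantile F0 0) (left_quantile F0 1).
              \<not> g differentiable (at (F0 x))} \<in> null_sets lebesgue"
    and b: "\<exists>\<gamma>. 0 < \<gamma> \<and> \<gamma> < 1 \<and>
              (\<integral>\<^sup>+x\<in>einterval (right_quantile F0 0) (left_quantile F0 1).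
                 ennreal (g (\<gamma> * F0 x) / (F0 x * \<phi> x)) \<partial>lborel) < \<infinity>"
    and R: "\<forall>X\<in>XX. R (rv_cdf M X) = distortion_risk_measure M g X"
  shows "(\<forall>v\<in>C_weight_at \<phi> F0.
            interval_lebesgue_integrable lborel (right_quantile F0 0) (left_quantile F0 1)
              (\<lambda>x. right_deriv g (F0 x) * v x)) \<and>
         has_quasi_hadamard_derivative (cdfs_of M XX) R F0
           (C_weight_at \<phi> F0) (D_weight_at \<phi> F0) (weighted_norm \<phi>)
           (\<lambda>v. LBINT x=right_quantile F0 0..left_quantile F0 1. right_deriv g (F0 x) * v x)"
proof -
  interpret prob_space M by fact
  note g = \<open>concave_distortion g\<close>
  note wf = \<open>weight_function \<phi>\<close>
  define S where "S = einterval (right_quantile F0 0) (left_quantile F0 1)"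
  have S[measurable]: "S \<in> sets borel" unfolding S_def by simp
  \<comment> \<open>With ordered endpoints the interval integral carries no sign and equals the
    integral over \<open>S\<close>.\<close>
  have le: "right_quantile F0 0 \<le> left_quantile F0 1"
    by (rule right_quantile_le_left_quantile) simp
  have XX: "random_variable borel X" "distortion_integrable M g X" if "X \<in> XX" for X
    using that assms(3,6) by (auto simp: subspace_L1_containing_Linf_def)
  obtain X0 where X0: "X0 \<in> XX" "F0 = rv_cdf M X0"
    using \<open>F0 \<in> cdfs_of M XX\<close> by (auto simp: cdfs_of_def)
  have cdfs: "mono F" "\<And>x. 0 \<le> F x" "\<And>x. F x \<le> 1" if "F \<in> cdfs_of M XX" for F
    using that rv_cdf_bounds[OF XX(1)] by (auto simp: cdfs_of_def)
  note F0 = cdfs[OF \<open>F0 \<in> cdfs_of M XX\<close>]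
  have gmeas: "(\<lambda>x. g (F x)) \<in> borel_measurable borel" if "F \<in> cdfs_of M XX" for F
    using cdfs[OF that] by (intro concave_distortion_comp_borel[OF g])
  note gF0 [measurable] = gmeas[OF \<open>F0 \<in> cdfs_of M XX\<close>]
  have F0_meas[measurable]: "F0 \<in> borel_measurable borel"
    by (rule borel_measurable_mono[OF F0(1)])
  have \<phi>_meas[measurable]: "\<phi> \<in> borel_measurable borel"
    using wf by (auto simp: weight_function_def intro: borel_measurable_continuous_onI)
  have \<phi>_ge: "1 \<le> \<phi> x" for x
    using wf by (auto simp: weight_function_def)
  have FS: "0 < F0 x" "F0 x < 1" if "x \<in> S" for x
    using cdf_strict_between_quantiles[OF F0(1)] that by (auto simp: S_def)

  \<comment> \<open>The integrable majorant\<close>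
  obtain c where c: "0 < c" "c < 1" and int_c:
    "(\<integral>\<^sup>+x\<in>S. ennreal (g (c * F0 x) / (F0 x * \<phi> x)) \<partial>lborel) < \<infinity>"
    using b by (auto simp: S_def)
  have cF: "0 \<le> c * F0 x" "c * F0 x \<le> 1" for x
    using F0 c by (auto intro: mult_le_one)
  have "mono (\<lambda>x. c * F0 x)"
    using F0(1) c by (auto simp: mono_def)
  then have gcF0[measurable]: "(\<lambda>x. g (c * F0 x)) \<in> borel_measurable borel"
    using cF by (intro concave_distortion_comp_borel[OF g])
  \<comment> \<open>The integrand of hypothesis (b), scaled by the constant of the increment bound.
    The weight in its denominator is paid for by perturbations of size at most
    \<open>K / \<phi> x\<close>, as \<open>slope_bound\<close> makes precise.\<close>
  define W where "W = (\<lambda>x. indicator S x * (g (c * F0 x) / (F0 x * \<phi> x) / (c * (1 - c))))"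
  have W_nonneg: "0 \<le> W x" for x
    unfolding W_def using concave_distortion_bounds(1)[OF g cF] F0(2)[of x] \<phi>_ge[of x] c
    by (auto intro!: mult_nonneg_nonneg divide_nonneg_nonneg)
  have W: "integrable lborel W"
  proof -
    have "integrable lborel (\<lambda>x. indicator S x * (g (c * F0 x) / (F0 x * \<phi> x)))"
    proof (rule integrableI_nonneg)
      show "AE x in lborel. 0 \<le> indicator S x * (g (c * F0 x) / (F0 x * \<phi> x))"
        using concave_distortion_bounds(1)[OF g cF] F0(2) order_trans[OF zero_le_one \<phi>_ge]
        by (auto intro!: mult_nonneg_nonneg divide_nonneg_nonneg)
      have "(\<integral>\<^sup>+x. ennreal (indicator S x * (g (c * F0 x) / (F0 x * \<phi> x))) \<partial>lborel)
          = (\<integral>\<^sup>+x\<in>S. ennreal (g (c * F0 x) / (F0 x * \<phi> x)) \<partial>lborel)"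
        by (intro nn_integral_cong) (auto simp: indicator_def)
      then show "(\<integral>\<^sup>+x. ennreal (indicator S x * (g (c * F0 x) / (F0 x * \<phi> x))) \<partial>lborel) < \<infinity>"
        using int_c by simp
    qed measurable
    from integrable_divide_zero[OF this, of "c * (1 - c)"] show ?thesis
      by (simp add: W_def)
  qed
  have slope_bound: "\<bar>z\<bar> * (g (c * F0 x) / F0 x / (c * (1 - c))) \<le> K * W x"
    if "x \<in> S" "\<bar>z\<bar> * \<phi> x \<le> K" for x z K
  proof -
    have "\<bar>z\<bar> * (g (c * F0 x) / F0 x / (c * (1 - c))) = (\<bar>z\<bar> * \<phi> x) * W x"
      using that(1) FS[OF that(1)] c \<phi>_ge[of x] by (auto simp: W_def field_simps)
    also have "\<dots> \<le> K * W x"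
      using that(2) W_nonneg by (intro mult_right_mono)
    finally show ?thesis .
  qed

  \<comment> \<open>Off \<open>S\<close> the value \<open>F0 x\<close> may be 0 or 1, where
    \<open>right_deriv\<close> may be an unspecified value; the indicator replaces it by 0.\<close>
  define r where "r = (\<lambda>x. indicator S x * right_deriv g (F0 x))"
  have r_meas[measurable]: "r \<in> borel_measurable borel"
  \<comment> \<open>The derivative is a pointwise limit of quotients in which \<open>g\<close> is
    composed only with monotone functions taking values in [0,1].\<close>
  proof (rule borel_measurable_LIMSEQ_real)
    fix x
    show "(\<lambda>n. indicator S x *
        (real (Suc n) * (g (min 1 (F0 x + 1 / real (Suc n))) - g (F0 x)))) \<longlonglongrightarrow> r x"
      unfolding r_def
      by (cases "x \<in> S") (auto intro!: right_deriv_tendsto_sequentially[OF g] FS simp del: of_nat_Suc)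
  next
    fix n
    have "mono (\<lambda>x. min 1 (F0 x + 1 / real (Suc n)))"
      using F0(1) by (intro monoI min.mono) (auto dest: monoD)
    then have [measurable]: "(\<lambda>x. g (min 1 (F0 x + 1 / real (Suc n)))) \<in> borel_measurable borel"
      using F0(2) by (intro concave_distortion_comp_borel[OF g]) (auto simp: min_def)
    show "(\<lambda>x. indicator S x *
        (real (Suc n) * (g (min 1 (F0 x + 1 / real (Suc n))) - g (F0 x)))) \<in> borel_measurable borel"
      by measurable
  qed
  have r_bound: "\<bar>r x * z\<bar> \<le> K * W x" if "\<bar>z\<bar> * \<phi> x \<le> K" for x z K
  proof (cases "x \<in> S")
    case True
    have "\<bar>r x * z\<bar> \<le> \<bar>z\<bar> * (g (c * F0 x) / F0 x / (c * (1 - c)))"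
      using right_deriv_bound[OF g c FS[OF True]] True
      by (simp add: r_def abs_mult mult.commute mult_left_mono del: times_divide_eq_right divide_divide_eq_left)
    also have "\<dots> \<le> K * W x" by (rule slope_bound[OF True that])
    finally show ?thesis .
  qed (simp add: r_def W_def)

  \<comment> \<open>The derivative as an absolutely convergent integral over the line\<close>
  have integral_eq: "(LBINT x=right_quantile F0 0..left_quantile F0 1. right_deriv g (F0 x) * v x)
      = (LINT x|lborel. r x * v x)" for v
    using le by (simp add: interval_lebesgue_integral_def set_lebesgue_integral_def S_def[symmetric]
        r_def mult.assoc)
  have CD: "C_weight_at \<phi> F0 \<subseteq> D_weight_at \<phi> F0" "D_weight_at \<phi> F0 \<subseteq> D_weight \<phi>"
    by (auto simp: C_weight_at_def D_weight_at_def)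
  \<comment> \<open>Comparison with the zero function turns \<open>abs_le_weighted_norm\<close> into
    a bound on a single function.\<close>
  have zero: "(\<lambda>_. 0) \<in> D_weight \<phi>"
    by (auto simp: D_weight_def cadlag_def bdd_above_def)
  have D_meas: "v \<in> borel_measurable borel" if "v \<in> D_weight \<phi>" for v
    using that cadlag_borel_measurable by (auto simp: D_weight_def)
  have integrable: "integrable lborel (\<lambda>x. r x * v x)" if v: "v \<in> D_weight \<phi>" for v
  proof (rule Bochner_Integration.integrable_bound)
    note [measurable] = D_meas[OF v]
    show "(\<lambda>x. r x * v x) \<in> borel_measurable lborel" by measurable
    show "integrable lborel (\<lambda>x. weighted_norm \<phi> (\<lambda>x. v x - 0) * W x)" using W by simp
    show "AE x in lborel. norm (r x * v x) \<le> norm (weighted_norm \<phi> (\<lambda>x. v x - 0) * W x)"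
      using r_bound[of "v _"] abs_le_weighted_norm[OF wf v zero]
      by (auto intro!: always_eventually order_trans[OF _ abs_ge_self])
  qed

  have part1: "interval_lebesgue_integrable lborel (right_quantile F0 0) (left_quantile F0 1)
      (\<lambda>x. right_deriv g (F0 x) * v x)" if "v \<in> C_weight_at \<phi> F0" for v
    using integrable[of v] that CD le
    by (auto simp: interval_lebesgue_integrable_def set_integrable_def S_def[symmetric]
        r_def mult.assoc)

  \<comment> \<open>Continuity of the derivative functional\<close>
  have cont: "\<exists>d>0. \<forall>w\<in>C_weight_at \<phi> F0. weighted_norm \<phi> (\<lambda>x. w x - v x) < d \<longrightarrow>
      \<bar>(LINT x|lborel. r x * w x) - (LINT x|lborel. r x * v x)\<bar> < e"
    if v: "v \<in> C_weight_at \<phi> F0" and e: "0 < e" for v e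
  proof -
    define I where "I = (LINT x|lborel. W x)"
    have I: "0 \<le> I" unfolding I_def using W_nonneg by simp
    have "\<bar>(LINT x|lborel. r x * w x) - (LINT x|lborel. r x * v x)\<bar> < e"
      if w: "w \<in> C_weight_at \<phi> F0" and d: "weighted_norm \<phi> (\<lambda>x. w x - v x) < e / (I + 1)" for w
    proof -
      define K where "K = weighted_norm \<phi> (\<lambda>x. w x - v x)"
      have vw: "v \<in> D_weight \<phi>" "w \<in> D_weight \<phi>" using v w CD by auto
      have "\<bar>(LINT x|lborel. r x * w x) - (LINT x|lborel. r x * v x)\<bar>
          = \<bar>LINT x|lborel. r x * (w x - v x)\<bar>"
        using integrable[OF vw(1)] integrable[OF vw(2)] by (simp add: right_diff_distrib)
      also have "\<dots> \<le> (LINT x|lborel. K * W x)"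
      proof (rule integral_abs_bound_integral)
        show "integrable lborel (\<lambda>x. r x * (w x - v x))"
          using integrable[OF vw(1)] integrable[OF vw(2)] by (simp add: right_diff_distrib)
        show "integrable lborel (\<lambda>x. K * W x)" using W by simp
        show "\<bar>r x * (w x - v x)\<bar> \<le> K * W x" for x
          using abs_le_weighted_norm[OF wf vw(2,1)] by (intro r_bound) (simp add: K_def)
      qed
      also have "\<dots> = K * I" by (simp add: I_def)
      \<comment> \<open>The radius is \<open>e / (I + 1)\<close> rather than \<open>e / I\<close>
        because \<open>I\<close> may be 0; the extra 1 also makes the final inequality
        strict.\<close>
      also have "\<dots> \<le> e / (I + 1) * I"
        using d I by (intro mult_right_mono) (auto simp: K_def)
      also have "\<dots> < e" using e I by (simp add: field_simps)
      finally show ?thesis .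
    qed
    then show ?thesis using e I by (intro exI[of _ "e / (I + 1)"]) auto
  qed

  \<comment> \<open>Hypothesis (a) speaks of the completed measure; covering the exceptional set by
    a null set of \<open>lborel\<close> transfers it to \<open>lborel\<close>.\<close>
  have diff_ae: "AE x in lborel. x \<in> S \<longrightarrow> g differentiable (at (F0 x))"
  proof -
    obtain N where "N \<in> null_sets lborel"
      "{x \<in> S. \<not> g differentiable (at (F0 x))} \<subseteq> N"
      using a unfolding null_sets_completion_iff2 S_def by auto
    then show ?thesis by (intro AE_I'[of N]) auto
  qed

  \<comment> \<open>Convergence of the difference quotients\<close>
  have lim: "(\<lambda>n. \<bar>(R (\<lambda>x. F0 x + h n * vs n x) - R F0) / h n - (LINT x|lborel. r x * v x)\<bar>) \<longlonglongrightarrow> 0"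
    if v: "v \<in> C_weight_at \<phi> F0" and vs: "\<And>n. vs n \<in> D_weight_at \<phi> F0"
      and conv: "(\<lambda>n::nat. weighted_norm \<phi> (\<lambda>x. vs n x - v x)) \<longlonglongrightarrow> 0"
      and cdf: "\<And>n. (\<lambda>x. F0 x + h n * vs n x) \<in> cdfs_of M XX"
      and h: "\<And>n. h n > 0" "h \<longlonglongrightarrow> 0" for v vs h
  proof -
    define F where "F = (\<lambda>n x. F0 x + h n * vs n x)"
    have cdf': "F n \<in> cdfs_of M XX" for n using cdf by (simp add: F_def)
    note [measurable] = gmeas[OF cdf']
    define K where "K = (\<lambda>n. weighted_norm \<phi> (\<lambda>x. vs n x - v x))"
    have vD: "v \<in> D_weight \<phi>" using v CD by blast
    have vsD: "vs n \<in> D_weight \<phi>" for n using vs[of n] CD by blast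
    note [measurable] = D_meas[OF vD]
    have K: "\<bar>vs n x - v x\<bar> * \<phi> x \<le> K n" for n x
      unfolding K_def by (rule abs_le_weighted_norm[OF wf vsD vD])
    have "Bseq K"
      using conv unfolding K_def by (rule convergent_imp_Bseq[OF convergentI])
    then obtain B where B: "\<And>n. K n \<le> B"
      unfolding Bseq_def by (auto dest: abs_le_D1)
    \<comment> \<open>By the triangle inequality this bounds the weighted size of all
      \<open>vs n\<close> at once, so the majorant \<open>L * W x\<close> is free of
      \<open>n\<close>.\<close>
    define L where "L = B + weighted_norm \<phi> (\<lambda>x. v x - 0)"
    have L: "\<bar>vs n x\<bar> * \<phi> x \<le> L" for n x
    proof -
      have "\<bar>vs n x\<bar> * \<phi> x \<le> (\<bar>vs n x - v x\<bar> + \<bar>v x\<bar>) * \<phi> x"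
        using \<phi>_ge[of x] by (intro mult_right_mono) auto
      also have "\<dots> \<le> L"
        using K[of n x] B[of n] abs_le_weighted_norm[OF wf vD zero, of x]
        by (simp add: L_def distrib_right)
      finally show ?thesis .
    qed
    \<comment> \<open>Since \<open>\<phi> \<ge> 1\<close>, the weighted norm dominates every
      pointwise difference.\<close>
    have ptw: "(\<lambda>n. vs n x) \<longlonglongrightarrow> v x" for x
    proof (rule LIM_zero_cancel, rule Lim_null_comparison)
      have "\<bar>vs n x - v x\<bar> \<le> \<bar>vs n x - v x\<bar> * \<phi> x" for n
        using mult_left_mono[OF \<phi>_ge[of x], of "\<bar>vs n x - v x\<bar>"] by simp
      then show "\<forall>\<^sub>F n in sequentially. norm (vs n x - v x) \<le> K n"
        using order_trans[OF _ K] by (auto intro!: always_eventually)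
      show "K \<longlonglongrightarrow> 0" using conv by (simp add: K_def)
    qed
    have quot: "(R (\<lambda>x. F0 x + h n * vs n x) - R F0) / h n
        = (LINT x|lborel. indicator S x * ((g (F n x) - g (F0 x)) / h n))" for n
    proof -
      obtain X where X: "X \<in> XX" "F n = rv_cdf M X"
        using cdf' by (auto simp: cdfs_of_def)
      \<comment> \<open>Perturbations vanish outside the closed interval while \<open>S\<close> is
        open, so only finite endpoints can be exceptional. For an infinite endpoint
        \<open>real_of_ereal\<close> gives 0, which merely enlarges the finite superset.\<close>
      have "countable {x. x \<notin> S \<and> F n x \<noteq> F0 x}"
      proof (rule countable_subset)
        show "{x. x \<notin> S \<and> F n x \<noteq> F0 x}
            \<subseteq> {real_of_ereal (right_quantile F0 0), real_of_ereal (left_quantile F0 1)}"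
        proof
          fix x assume "x \<in> {x. x \<notin> S \<and> F n x \<noteq> F0 x}"
          then have x: "x \<notin> S" "F n x \<noteq> F0 x" by auto
          then have "vs n x \<noteq> 0" by (auto simp: F_def)
          then have "right_quantile F0 0 \<le> ereal x" "ereal x \<le> left_quantile F0 1"
            using vs[of n] by (auto simp: D_weight_at_def)
          then have "ereal x = right_quantile F0 0 \<or> ereal x = left_quantile F0 1"
            using x(1) by (auto simp: S_def einterval_def)
          then show "x \<in> {real_of_ereal (right_quantile F0 0), real_of_ereal (left_quantile F0 1)}"
            by (metis insert_iff real_of_ereal.simps(1))
        qed
      qed simp
      then have "AE x in lborel. x \<notin> S \<longrightarrow> F n x = F0 x"
        by (intro AE_I'[OF countable_imp_null_set_lborel]) auto
      then have "R (F n) - R F0 = (LINT x|lborel. indicator S x * (g (F n x) - g (F0 x)))"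
        using distortion_risk_measure_diff[OF g XX[OF X(1)] XX[OF X0(1)], of S] R X X0 by simp
      then show ?thesis
        by (simp only: F_def times_divide_eq_right integral_divide_zero)
    qed
    have "(\<lambda>n. LINT x|lborel. indicator S x * ((g (F n x) - g (F0 x)) / h n))
        \<longlonglongrightarrow> (LINT x|lborel. r x * v x)"
    proof (rule integral_dominated_convergence)
      show "(\<lambda>x. r x * v x) \<in> borel_measurable lborel" by measurable
      show "(\<lambda>x. indicator S x * ((g (F n x) - g (F0 x)) / h n)) \<in> borel_measurable lborel" for n
        by measurable
      show "integrable lborel (\<lambda>x. L * W x)" using W by simp
      show "AE x in lborel. (\<lambda>n. indicator S x * ((g (F n x) - g (F0 x)) / h n)) \<longlonglongrightarrow> r x * v x"
        using diff_ae
      proof eventually_elim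
        case (elim x)
        show ?case
        proof (cases "x \<in> S")
          case True
          then show ?thesis
            using difference_quotient_tendsto[OF _ ptw[of x] h(2,1)] elim
            by (simp add: r_def F_def)
        qed (simp add: r_def)
      qed
      show "AE x in lborel. norm (indicator S x * ((g (F n x) - g (F0 x)) / h n)) \<le> L * W x" for n
      proof (rule always_eventually, intro allI)
        fix x
        show "norm (indicator S x * ((g (F n x) - g (F0 x)) / h n)) \<le> L * W x"
        proof (cases "x \<in> S")
          case True
          \<comment> \<open>As \<open>F n\<close> is a distribution function, \<open>F n x\<close>
            lies in [0,1], so the increment bound applies however large the perturbation is relative
            to \<open>F0 x\<close>.\<close>
          have "\<bar>g (F n x) - g (F0 x)\<bar> \<le> \<bar>F n x - F0 x\<bar> * (g (c * F0 x) / F0 x / (c * (1 - c)))"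
            using cdfs[OF cdf'] by (intro concave_distortion_increment_bound[OF g c FS[OF True]])
          also have "\<dots> = h n * (\<bar>vs n x\<bar> * (g (c * F0 x) / F0 x / (c * (1 - c))))"
            using h(1)[of n] by (simp add: F_def abs_mult)
          also have "\<dots> \<le> h n * (L * W x)"
            using h(1)[of n] slope_bound[OF True L] by (intro mult_left_mono) auto
          finally show ?thesis
            using True h(1)[of n] by (simp add: field_simps)
        qed (simp add: W_def)
      qed
    qed
    then show ?thesis
      unfolding quot by (intro tendsto_rabs_zero LIM_zero)
  qed
  show ?thesis
    unfolding has_quasi_hadamard_derivative_def integral_eq
    using part1 cont lim by blast
qed

end
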